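(* Let $A\in\mathcal{M}_{m,n}$, $r=\mathrm{rank}(A)$ and $q=\min\{m,n\}$. Let $\{f_1,\ldots,f_{q-r}\}$ be an orthonormal subset of $\mathrm{N}(A)$ and $\{g_1,\ldots,g_{q-r}\}$ be an orthonormal subset of $\mathrm{N}(A^{*})$. Let $\{d_k\}_{k=1}^{q-r}\subset\mathbb{F}\setminus\{0\}$. Then (the inverses below existing in the respective cases): (i) If $m\geq n$, then $A^{\dagger}=\left(A^{*}A+\sum_{k=1}^{q-r}d_k^{2}f_kf_k^{*}\right)^{-1}\left(A^{*}+\sum_{k=1}^{q-r}d_kf_kg_k^{*}\right)-\sum_{k=1}^{q-r}\frac{1}{d_k}f_kg_k^{*}$. (ii) If $n\geq m$, then $A^{\dagger}=\left(A^{*}+\sum_{k=1}^{q-r}d_kf_kg_k^{*}\right)\left(AA^{*}+\sum_{k=1}^{q-r}d_k^{2}g_kg_k^{*}\right)^{-1}-\sum_{k=1}^{q-r}\frac{1}{d_k}f_kg_k^{*}$. (iii) If $m=n$, then $A^{\dagger}=\left(A+\sum_{k=1}^{q-r}d_kg_kf_k^{*}\right)^{-1}-\sum_{k=1}^{q-r}\frac{1}{d_k}f_kg_k^{*}$.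
   Context: $\mathbb{F}=\mathbb{R}$ or $\mathbb{F}=\mathbb{C}$; $\mathcal{M}_{m,n}$ is the set of $m\times n$ matrices over $\mathbb{F}$; vectors in $\mathbb{F}^n$ are column vectors; $A^{*}$ is the conjugate transpose and $\mathrm{N}(A)$ the null space of $A$. $A^{\dagger}$ is the Moore--Penrose inverse: the unique matrix $X$ with $AXA=A$, $XAX=X$, $(AX)^{*}=AX$, $(XA)^{*}=XA$. *)

theory Defs
  imports
    "Jordan_Normal_Form.DL_Rank"
    "Jordan_Normal_Form.Matrix_Kernel"
    "Jordan_Normal_Form.Schur_Decomposition"
    "Jordan_Normal_Form.Gauss_Jordan_Elimination"
begin

definition is_moore_penrose :: "'a :: conjugatable_field mat \<Rightarrow> 'a mat \<Rightarrow> bool" where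
  "is_moore_penrose A X \<longleftrightarrow>
     X \<in> carrier_mat (dim_col A) (dim_row A) \<and>
     A * X * A = A \<and> X * A * X = X \<and>
     mat_adjoint (A * X) = A * X \<and> mat_adjoint (X * A) = X * A"

definition pinv :: "'a :: conjugatable_field mat \<Rightarrow> 'a mat" where
  "pinv A = (THE X. is_moore_penrose A X)"

(* The matrix v w^* for column vectors v and w. *)
definition outer :: "'a :: conjugatable_field vec \<Rightarrow> 'a vec \<Rightarrow> 'a mat" where
  "outer v w = mat (dim_vec v) (dim_vec w) (\<lambda>(i, j). v $ i * conjugate (w $ j))"

(* An indexed family, so that distinct indices give distinct (orthogonal) vectors. *)
definition orthonormal_family :: "'i set \<Rightarrow> ('i \<Rightarrow> 'a :: conjugatable_field vec) \<Rightarrow> bool" where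
  "orthonormal_family I f \<longleftrightarrow> (\<forall>i\<in>I. \<forall>j\<in>I. f i \<bullet>c f j = (if i = j then 1 else 0))"

(* Matrices of all sizes share one type, so a sum of matrices has to be taken
   in the additive group of the nr x nc matrices. *)
abbreviation mat_sum :: "nat \<Rightarrow> nat \<Rightarrow> ('i \<Rightarrow> 'a :: field mat) \<Rightarrow> 'i set \<Rightarrow> 'a mat" where
  "mat_sum nr nc M I \<equiv> finsum (module_mat TYPE('a) nr nc) M I"

(* Meaningful only for invertible M; otherwise mat_inverse M = None. *)
abbreviation minv :: "'a :: field mat \<Rightarrow> 'a mat" where
  "minv M \<equiv> the (mat_inverse M)"

end

(* Write F and G for the matrices with columns f_k and g_k, and D for the diagonal matrix of the d_k.
   A full rank factorization A = C W, with one-sided inverses L of C and R of W for which C L and R W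
   are Hermitian, gives the Moore-Penrose inverse X = R L. If q = n, then the columns of F complement
   those of R to a basis of the whole space, so that X A + F F^* = 1; if q = m, then likewise
   A X + G G^* = 1. All products of A, X with F, G that should vanish do vanish, whence
     (A^* A + F D^2 F^* )^-1 = X X^* + F D^-2 F^*,
     (A A^* + G D^2 G^* )^-1 = X^* X + G D^-2 G^*,
     (A + G D F^* )^-1 = X + F D^-1 G^*,
   and the three formulas follow by multiplying out. *)
theory Submission
  imports Defs
begin

section \<open>Matrix algebra with side conditions stated as dimension equations, so that
  \<open>simp\<close> can discharge them\<close>

lemma mult_assoc_mat_dim:
  fixes A :: "'a :: semiring_0 mat"
  assumes "dim_col A = dim_row B" "dim_col B = dim_row C"
  shows "(A * B) * C = A * (B * C)"
  using assms by (intro assoc_mult_mat[of A "dim_row A" "dim_col A" B "dim_col B" C "dim_col C"]) auto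

lemma add_mult_distrib_mat_dim:
  fixes A :: "'a :: semiring_0 mat"
  assumes "dim_row A = dim_row B" "dim_col A = dim_col B" "dim_col A = dim_row C"
  shows "(A + B) * C = A * C + B * C"
  using assms by (intro add_mult_distrib_mat[of A "dim_row A" "dim_col A" B C "dim_col C"]) auto

lemma mult_add_distrib_mat_dim:
  fixes A :: "'a :: semiring_0 mat"
  assumes "dim_col A = dim_row B" "dim_row B = dim_row C" "dim_col B = dim_col C"
  shows "A * (B + C) = A * B + A * C"
  using assms by (intro mult_add_distrib_mat[of A "dim_row A" "dim_col A" B "dim_col B" C]) auto

text \<open>Once products are nested to the right, P Q is no longer a subterm of P (Q Y). This form
  lets a known product act inside a longer chain.\<close>

lemma reassoc_mat:
  fixes P :: "'a :: semiring_0 mat"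
  assumes "P * Q = Z" "dim_col P = dim_row Q" "dim_col Q = dim_row Y"
  shows "P * (Q * Y) = Z * Y"
  using assms mult_assoc_mat_dim by metis

lemmas mat_distribs = mult_assoc_mat_dim add_mult_distrib_mat_dim mult_add_distrib_mat_dim

section \<open>The conjugate transpose\<close>

lemma dim_mat_adjoint [simp]:
  "dim_row (mat_adjoint A) = dim_col A" "dim_col (mat_adjoint A) = dim_row A"
  by (auto simp: mat_adjoint_def)

lemma mat_adjoint_carrier [simp]:
  "A \<in> carrier_mat nr nc \<Longrightarrow> mat_adjoint A \<in> carrier_mat nc nr"
  by auto

lemma mat_adjoint_index [simp]:
  "i < dim_col A \<Longrightarrow> j < dim_row A \<Longrightarrow> mat_adjoint A $$ (i, j) = conjugate (A $$ (j, i))"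
  by (simp add: mat_adjoint_def mat_of_rows_index)

lemma mat_adjoint_adjoint [simp]: "mat_adjoint (mat_adjoint A) = A"
  by (rule eq_matI) auto

lemma conjugate_one [simp]: "conjugate (1 :: 'a :: conjugatable_field) = 1"
proof -
  have "conjugate (conjugate (1 :: 'a) * 1) = 1 * conjugate 1"
    by (simp only: conjugate_dist_mul conjugate_id)
  then show ?thesis by simp
qed

lemma mat_adjoint_mult:
  assumes "dim_col A = dim_row B"
  shows "mat_adjoint (A * B) = mat_adjoint B * mat_adjoint A"
  using assms
  by (intro eq_matI)
     (auto simp: scalar_prod_def sum_conjugate conjugate_dist_mul mult.commute intro!: sum.cong)

lemma mat_adjoint_one [simp]: "mat_adjoint (1\<^sub>m n) = 1\<^sub>m n"
  by (rule eq_matI) auto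

lemma mat_adjoint_zero [simp]: "mat_adjoint (0\<^sub>m nr nc) = 0\<^sub>m nc nr"
  by (rule eq_matI) auto

section \<open>One-sided inverses and the full rank factorization\<close>

lemma mat_adjoint_mult_vec_eq_0D:
  fixes A :: "'a :: conjugatable_ordered_field mat"
  assumes A: "A \<in> carrier_mat m n" and v: "v \<in> carrier_vec n"
    and 0: "mat_adjoint A *\<^sub>v (A *\<^sub>v v) = 0\<^sub>v n"
  shows "A *\<^sub>v v = 0\<^sub>v m"
proof -
  let ?w = "A *\<^sub>v v"
  have w: "?w \<in> carrier_vec m" using A v by auto
  \<comment> \<open>Moving the adjoint across the inner product turns this zero into the squared
    norm of w = A v; definiteness then gives w = 0.\<close>
  have "0 = (mat_adjoint A *\<^sub>v ?w) \<bullet>c v" using 0 v by simp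
  also have "\<dots> = (\<Sum>i<n. \<Sum>j<m. conjugate (A $$ (j, i)) * ?w $ j * conjugate (v $ i))"
    using A v by (auto simp: scalar_prod_def sum_distrib_right lessThan_atLeast0 intro!: sum.cong)
  also have "\<dots> = (\<Sum>j<m. \<Sum>i<n. conjugate (A $$ (j, i)) * ?w $ j * conjugate (v $ i))"
    by (rule sum.swap)
  also have "\<dots> = ?w \<bullet>c ?w"
    using A v by (auto simp: scalar_prod_def sum_distrib_left sum_conjugate conjugate_dist_mul
        lessThan_atLeast0 ac_simps intro!: sum.cong)
  finally show ?thesis using w by simp
qed

text \<open>The witness is L = H C^* with H the inverse of the Gram matrix C^* C. That matrix is
  nonsingular because C^* C v = 0 already forces C v = 0, and C L = C H C^* is Hermitian because H
  is.\<close>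

lemma injective_mat_left_inverse:
  fixes C :: "'a :: conjugatable_ordered_field mat"
  assumes C: "C \<in> carrier_mat m r"
    and inj: "\<And>v. v \<in> carrier_vec r \<Longrightarrow> C *\<^sub>v v = 0\<^sub>v m \<Longrightarrow> v = 0\<^sub>v r"
  obtains L where "L \<in> carrier_mat r m" "L * C = 1\<^sub>m r" "mat_adjoint (C * L) = C * L"
proof -
  let ?G = "mat_adjoint C * C"
  have G: "?G \<in> carrier_mat r r" using C by auto
  have "det ?G \<noteq> 0"
  proof
    assume "det ?G = 0"
    then obtain v where v: "v \<in> carrier_vec r" "v \<noteq> 0\<^sub>v r" "?G *\<^sub>v v = 0\<^sub>v r"
      using det_0_iff_vec_prod_zero_field[OF G] by auto
    then have "mat_adjoint C *\<^sub>v (C *\<^sub>v v) = 0\<^sub>v r"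
      using C by (metis assoc_mult_mat_vec mat_adjoint_carrier)
    then show False using inj mat_adjoint_mult_vec_eq_0D[OF C] v by blast
  qed
  then obtain H where H: "H \<in> carrier_mat r r" "H * ?G = 1\<^sub>m r" "?G * H = 1\<^sub>m r"
    using det_non_zero_imp_unit[OF G] by (auto simp: Units_def ring_mat_def)
  have dims [simp]: "dim_row C = m" "dim_col C = r" "dim_row H = r" "dim_col H = r"
    using C H by auto
  \<comment> \<open>The Gram matrix is its own adjoint, so H^* is a left inverse of it; it must
    agree with the right inverse H.\<close>
  have "mat_adjoint H * ?G = mat_adjoint (?G * H)"
    by (simp add: mat_adjoint_mult mult_assoc_mat_dim)
  then have "mat_adjoint H * ?G = 1\<^sub>m r" using H by simp
  then have "mat_adjoint H * (?G * H) = 1\<^sub>m r * H" by (intro reassoc_mat) auto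
  then have adj_H: "mat_adjoint H = H" using H by simp
  show thesis
  proof (rule that)
    show "H * mat_adjoint C \<in> carrier_mat r m" by auto
    show "H * mat_adjoint C * C = 1\<^sub>m r" using H by (simp add: mult_assoc_mat_dim)
    show "mat_adjoint (C * (H * mat_adjoint C)) = C * (H * mat_adjoint C)"
      by (simp add: mat_adjoint_mult adj_H mult_assoc_mat_dim)
  qed
qed

text \<open>The four relations say that a block column of the V's times a block row of the U's is
  the identity. As r + p = n, both are square, so they also multiply to the identity in the other
  order, which is the claim.\<close>

lemma complementary_bases_resolution:
  fixes U\<^sub>1 :: "'a :: field mat"
  assumes U: "U\<^sub>1 \<in> carrier_mat n r" "U\<^sub>2 \<in> carrier_mat n p"
    and V: "V\<^sub>1 \<in> carrier_mat r n" "V\<^sub>2 \<in> carrier_mat p n"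
    and n: "r + p = n"
    and VU: "V\<^sub>1 * U\<^sub>1 = 1\<^sub>m r" "V\<^sub>1 * U\<^sub>2 = 0\<^sub>m r p" "V\<^sub>2 * U\<^sub>1 = 0\<^sub>m p r" "V\<^sub>2 * U\<^sub>2 = 1\<^sub>m p"
  shows "U\<^sub>1 * V\<^sub>1 + U\<^sub>2 * V\<^sub>2 = 1\<^sub>m n"
proof -
  \<comment> \<open>The blocks of width or height 0 make \<open>four_block_mat\<close> stack two
    matrices or set them side by side.\<close>
  let ?V = "four_block_mat V\<^sub>1 (0\<^sub>m r 0) V\<^sub>2 (0\<^sub>m p 0)"
  let ?U = "four_block_mat U\<^sub>1 U\<^sub>2 (0\<^sub>m 0 r) (0\<^sub>m 0 p)"
  have carr: "?V \<in> carrier_mat n n" "?U \<in> carrier_mat n n" using U V n by auto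
  have "?V * ?U = four_block_mat (1\<^sub>m r) (0\<^sub>m r p) (0\<^sub>m p r) (1\<^sub>m p)"
    using U V VU by (subst mult_four_block_mat[of _ r n _ 0 _ p _ _ r _ p]) auto
  also have "\<dots> = 1\<^sub>m n" using n by (intro eq_matI) auto
  finally have "?U * ?V = 1\<^sub>m n"
    using mat_mult_left_right_inverse carr by blast
  moreover have "?U * ?V = four_block_mat (U\<^sub>1 * V\<^sub>1 + U\<^sub>2 * V\<^sub>2) (0\<^sub>m n 0) (0\<^sub>m 0 n) (0\<^sub>m 0 0)"
    using U V by (subst mult_four_block_mat[of _ n r _ p _ 0 _ _ n _ 0]) auto
  moreover have "\<dots> = U\<^sub>1 * V\<^sub>1 + U\<^sub>2 * V\<^sub>2" using U V by (intro eq_matI) auto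
  ultimately show ?thesis by simp
qed

text \<open>The columns of C are a maximal independent set of columns of A, and W holds the
  coordinates of all columns of A in that basis. Injectivity of C and of W^* then yields L and
  R.\<close>

lemma rank_factorization:
  fixes A :: "'a :: conjugatable_ordered_field mat"
  assumes A: "A \<in> carrier_mat m n" and r: "r = vec_space.rank m A"
  obtains C W L R where
    "C \<in> carrier_mat m r" "W \<in> carrier_mat r n" "L \<in> carrier_mat r m" "R \<in> carrier_mat n r"
    "A = C * W" "L * C = 1\<^sub>m r" "W * R = 1\<^sub>m r"
    "mat_adjoint (C * L) = C * L" "mat_adjoint (R * W) = R * W" "r \<le> m" "r \<le> n"
proof -
  interpret vec_space "TYPE('a)" m .
  have cols_A: "set (cols A) \<subseteq> carrier_vec m" using A cols_dim by blast
  obtain S where S: "finite S" "maximal S (\<lambda>T. T \<subseteq> set (cols A) \<and> lin_indpt T)"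
    using maximal_exists_superset[of "set (cols A)" "\<lambda>T. T \<subseteq> set (cols A) \<and> lin_indpt T" "{}"]
    by (meson List.finite_set empty_subsetI finite_lin_indpt2 finite.emptyI empty_iff)
  then have S_cols: "S \<subseteq> set (cols A)" and indep: "lin_indpt S"
    by (auto simp: maximal_def)
  have S_carr: "S \<subseteq> carrier_vec m" using S_cols cols_A by blast
  obtain ss where ss: "set ss = S" "distinct ss" using S(1) finite_distinct_list by blast
  have len: "length ss = r"
    using rank_card_indpt[OF A S(2)] r ss distinct_card by fastforce
  define C where "C = mat_of_cols m ss"
  have C: "C \<in> carrier_mat m r" unfolding C_def by (simp flip: len)
  have cols_C: "cols C = ss" unfolding C_def using ss S_carr by simp
  have in_span: "\<exists>w \<in> carrier_vec r. C *\<^sub>v w = x" if x: "x \<in> set (cols A)" for x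
  proof -
    have "x \<in> span S"
    proof (cases "x \<in> S")
      case True
      then show ?thesis using in_own_span[of S] S_carr by auto
    next
      case False
      then have "lin_dep (S \<union> {x})"
        using S(2) x S_cols unfolding maximal_def by blast
      then show ?thesis
        using lin_dep_iff_in_span[of S x] S_carr indep False x cols_A by auto
    qed
    then obtain a where "lincomb a S = x" using finite_in_span[OF S(1)] S_carr by auto
    then have "C *\<^sub>v vec r (\<lambda>i. a (col C i)) = x"
      using mat_mult_eq_lincomb[OF C] cols_C ss by simp
    then show ?thesis by (intro bexI) auto
  qed
  then obtain w where w: "\<And>x. x \<in> set (cols A) \<Longrightarrow> w x \<in> carrier_vec r \<and> C *\<^sub>v w x = x"
    by metis
  define W where "W = mat_of_cols r (map w (cols A))"
  have W: "W \<in> carrier_mat r n" unfolding W_def using A by auto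
  have A_eq: "A = C * W"
  proof (rule mat_col_eqI)
    fix j assume "j < dim_col (C * W)"
    then have j: "j < n" using W by auto
    then have col_A: "col A j \<in> set (cols A)" using A by (auto simp: cols_def)
    then have "col W j = w (col A j)"
      using j A w[OF col_A] by (auto simp: W_def cols_def intro!: col_mat_of_cols)
    then have "col (C * W) j = C *\<^sub>v w (col A j)"
      by (simp only: col_mult2[OF C W j])
    then show "col A j = col (C * W) j" using w[OF col_A] by simp
  qed (use A C W in auto)
  have C_inj: "v = 0\<^sub>v r" if "v \<in> carrier_vec r" "C *\<^sub>v v = 0\<^sub>v m" for v
    using lin_depI[OF C that(1) _ that(2)] cols_C ss indep by auto
  then obtain L where L: "L \<in> carrier_mat r m" "L * C = 1\<^sub>m r" "mat_adjoint (C * L) = C * L"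
    using injective_mat_left_inverse[OF C] by blast
  have dims [simp]: "dim_row A = m" "dim_col A = n" "dim_row C = m" "dim_col C = r"
    "dim_row W = r" "dim_col W = n" "dim_row L = r" "dim_col L = m"
    using A C W L by auto
  have "\<exists>j < n. ss ! i = col A j" if "i < r" for i
    using that len ss S_cols nth_mem[of i ss] by (force simp: cols_def)
  then obtain s where s: "\<And>i. i < r \<Longrightarrow> s i < n \<and> ss ! i = col A (s i)" by metis
  \<comment> \<open>A selection matrix: it picks from A the columns that form C. Cancelling C by L
    in C W \<open>R\<^sub>0\<close> = C shows that W has a right inverse, hence that W^* is
    injective. The final R is a different right inverse, chosen to make R W Hermitian.\<close>
  define R\<^sub>0 where "R\<^sub>0 = mat n r (\<lambda>(i, j). if i = s j then 1 else 0 :: 'a)"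
  have dims' [simp]: "dim_row R\<^sub>0 = n" "dim_col R\<^sub>0 = r" by (auto simp: R\<^sub>0_def)
  have "A * R\<^sub>0 = C"
  proof (rule eq_matI)
    fix i j assume ij: "i < dim_row C" "j < dim_col C"
    then have "(A * R\<^sub>0) $$ (i, j) = (\<Sum>k<n. A $$ (i, k) * (if k = s j then 1 else 0))"
      by (simp add: scalar_prod_def R\<^sub>0_def lessThan_atLeast0)
    also have "\<dots> = A $$ (i, s j)" using s ij by (simp add: if_distrib cong: if_cong)
    also have "\<dots> = C $$ (i, j)" using s ij len by (simp add: C_def mat_of_cols_index)
    finally show "(A * R\<^sub>0) $$ (i, j) = C $$ (i, j)" .
  qed auto
  then have "L * (C * (W * R\<^sub>0)) = L * C" by (simp add: A_eq mult_assoc_mat_dim)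
  moreover have "L * (C * (W * R\<^sub>0)) = W * R\<^sub>0" using L by (subst reassoc_mat[of L C]) auto
  ultimately have WR\<^sub>0: "W * R\<^sub>0 = 1\<^sub>m r" using L by simp
  have W': "mat_adjoint W \<in> carrier_mat n r" by auto
  have W_inj: "v = 0\<^sub>v r" if v: "v \<in> carrier_vec r" "mat_adjoint W *\<^sub>v v = 0\<^sub>v n" for v
  proof -
    have "v = mat_adjoint (W * R\<^sub>0) *\<^sub>v v" using WR\<^sub>0 v by simp
    also have "\<dots> = mat_adjoint R\<^sub>0 *\<^sub>v (mat_adjoint W *\<^sub>v v)"
      using v(1) by (subst mat_adjoint_mult, simp) (intro assoc_mult_mat_vec[of _ r n], auto)
    finally show ?thesis using v by (auto simp: scalar_prod_def intro!: eq_vecI)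
  qed
  \<comment> \<open>The adjoint of this left inverse of W^* serves as R.\<close>
  then obtain L' where L': "L' \<in> carrier_mat r n" "L' * mat_adjoint W = 1\<^sub>m r"
    "mat_adjoint (mat_adjoint W * L') = mat_adjoint W * L'"
    using injective_mat_left_inverse[OF W'] by blast
  have dims'' [simp]: "dim_row L' = r" "dim_col L' = n" using L' by auto
  show thesis
  proof (rule that[OF C W L(1) _ A_eq L(2) _ L(3)])
    show "mat_adjoint L' \<in> carrier_mat n r" by auto
    have "W * mat_adjoint L' = mat_adjoint (L' * mat_adjoint W)" by (simp add: mat_adjoint_mult)
    then show "W * mat_adjoint L' = 1\<^sub>m r" using L' by simp
    have "mat_adjoint L' * W = mat_adjoint (mat_adjoint W * L')" by (simp add: mat_adjoint_mult)
    then show "mat_adjoint (mat_adjoint L' * W) = mat_adjoint L' * W"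
      using L' by (simp add: mat_adjoint_mult)
    show "r \<le> n" using rank_le_nc[OF A] r by simp
    show "r \<le> m"
      using li_le_dim[OF fin_dim _ indep] S_carr ss len distinct_card dim_is_n by fastforce
  qed
qed

section \<open>The Moore-Penrose inverse: uniqueness, existence and resolutions of the
  identity\<close>

lemma is_moore_penrose_unique:
  assumes X: "is_moore_penrose A X" and Y: "is_moore_penrose A Y"
  shows "X = Y"
proof -
  have dims [simp]: "dim_row X = dim_col A" "dim_col X = dim_row A"
     "dim_row Y = dim_col A" "dim_col Y = dim_row A"
    using X Y by (auto simp: is_moore_penrose_def)
  have X': "A * X * A = A" "X * A * X = X" "mat_adjoint (A * X) = A * X" "mat_adjoint (X * A) = X * A"
    and Y': "A * Y * A = A" "Y * A * Y = Y" "mat_adjoint (A * Y) = A * Y" "mat_adjoint (Y * A) = Y * A"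
    using X Y by (auto simp: is_moore_penrose_def)
  \<comment> \<open>Taking adjoints swaps the Hermitian factors A Y and A X: the product A Y A X
    equals A X, while A X A Y equals A Y.\<close>
  have "A * X = mat_adjoint (A * Y * A * X)" using X' Y' by simp
  also have "\<dots> = mat_adjoint (A * X) * mat_adjoint (A * Y)"
    by (simp add: mult_assoc_mat_dim flip: mat_adjoint_mult)
  also have "\<dots> = A * X * A * Y" unfolding X'(3) Y'(3) by (simp add: mult_assoc_mat_dim)
  also have "\<dots> = A * Y" using X' by simp
  finally have AX: "A * X = A * Y" .
  have "X * A = mat_adjoint (X * (A * Y * A))" using X' Y' by simp
  also have "\<dots> = mat_adjoint (Y * A) * mat_adjoint (X * A)"
    by (simp add: mult_assoc_mat_dim flip: mat_adjoint_mult)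
  also have "\<dots> = Y * (A * X * A)" unfolding X'(4) Y'(4) by (simp add: mult_assoc_mat_dim)
  also have "\<dots> = Y * A" using X' by simp
  finally have XA: "X * A = Y * A" .
  have "X = X * A * X" using X' by simp
  also have "\<dots> = Y * (A * X)" by (simp add: XA mult_assoc_mat_dim)
  also have "\<dots> = Y * A * Y" by (simp add: AX mult_assoc_mat_dim)
  finally show ?thesis using Y' by simp
qed

lemma pinv_eqI: "is_moore_penrose A X \<Longrightarrow> pinv A = X"
  unfolding pinv_def using is_moore_penrose_unique by (metis the_equality)

lemma pinv_resolutions:
  fixes A :: "'a :: conjugatable_ordered_field mat"
  assumes A: "A \<in> carrier_mat m n" and r: "r = vec_space.rank m A"
  shows "is_moore_penrose A (pinv A)"
    and "\<And>F. F \<in> carrier_mat n (n - r) \<Longrightarrow> A * F = 0\<^sub>m m (n - r) \<Longrightarrow>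
           mat_adjoint F * F = 1\<^sub>m (n - r) \<Longrightarrow> pinv A * A + F * mat_adjoint F = 1\<^sub>m n"
    and "\<And>G. G \<in> carrier_mat m (m - r) \<Longrightarrow> mat_adjoint A * G = 0\<^sub>m n (m - r) \<Longrightarrow>
           mat_adjoint G * G = 1\<^sub>m (m - r) \<Longrightarrow> A * pinv A + G * mat_adjoint G = 1\<^sub>m m"
proof -
  obtain C W L R where carr: "C \<in> carrier_mat m r" "W \<in> carrier_mat r n"
      "L \<in> carrier_mat r m" "R \<in> carrier_mat n r"
    and A_eq: "A = C * W" and LC: "L * C = 1\<^sub>m r" and WR: "W * R = 1\<^sub>m r"
    and herm: "mat_adjoint (C * L) = C * L" "mat_adjoint (R * W) = R * W"
    and r_le: "r \<le> m" "r \<le> n"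
    using rank_factorization[OF A r] by metis
  have dims [simp]: "dim_row C = m" "dim_col C = r" "dim_row W = r" "dim_col W = n"
      "dim_row L = r" "dim_col L = m" "dim_row R = n" "dim_col R = r"
    using carr by auto
  note cancel = LC WR reassoc_mat[OF LC] reassoc_mat[OF WR]
  have AX: "A * (R * L) = C * L" and XA: "R * L * A = R * W"
    by (simp_all add: A_eq mult_assoc_mat_dim cancel)
  have "is_moore_penrose A (R * L)"
    unfolding is_moore_penrose_def AX XA herm
    using A by (auto simp: A_eq mult_assoc_mat_dim cancel)
  moreover from pinv_eqI[OF this] have pinv: "pinv A = R * L" .
  ultimately show "is_moore_penrose A (pinv A)" by simp
  show "pinv A * A + F * mat_adjoint F = 1\<^sub>m n"
    if F: "F \<in> carrier_mat n (n - r)" "A * F = 0\<^sub>m m (n - r)" "mat_adjoint F * F = 1\<^sub>m (n - r)" for F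
  proof -
    have dimF [simp]: "dim_row F = n" "dim_col F = n - r" using F by auto
    have "W * F = L * (A * F)" by (simp add: A_eq mult_assoc_mat_dim cancel)
    then have WF: "W * F = 0\<^sub>m r (n - r)" using F carr by simp
    \<comment> \<open>Replacing R W by its adjoint W^* R^* brings W^* next to F^*, and F^* W^* is
      the adjoint of W F = 0.\<close>
    have "R = R * W * R" by (simp add: mult_assoc_mat_dim cancel)
    then have "mat_adjoint F * R = mat_adjoint F * (mat_adjoint (R * W) * R)"
      by (simp add: herm)
    also have "\<dots> = mat_adjoint (W * F) * (mat_adjoint R * R)"
      by (simp add: mat_adjoint_mult mult_assoc_mat_dim)
    also have "\<dots> = 0\<^sub>m (n - r) r" by (simp add: WF)
    finally have "R * W + F * mat_adjoint F = 1\<^sub>m n"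
      using carr F WF WR r_le by (intro complementary_bases_resolution[of R n r F "n - r"]) auto
    then show ?thesis by (simp add: pinv XA)
  qed
  show "A * pinv A + G * mat_adjoint G = 1\<^sub>m m"
    if G: "G \<in> carrier_mat m (m - r)" "mat_adjoint A * G = 0\<^sub>m n (m - r)"
      "mat_adjoint G * G = 1\<^sub>m (m - r)" for G
  proof -
    have dimG [simp]: "dim_row G = m" "dim_col G = m - r" using G by auto
    \<comment> \<open>R^* cancels W^* in A^* G = W^* C^* G, which leaves C^* G = 0.\<close>
    have "mat_adjoint R * (mat_adjoint A * G) = mat_adjoint (W * R) * (mat_adjoint C * G)"
      by (simp add: A_eq mult_assoc_mat_dim mat_adjoint_mult)
    then have CG: "mat_adjoint C * G = 0\<^sub>m r (m - r)" by (simp add: G WR)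
    have "mat_adjoint G * C = mat_adjoint (mat_adjoint C * G)" by (simp add: mat_adjoint_mult)
    then have GC: "mat_adjoint G * C = 0\<^sub>m (m - r) r" by (simp add: CG)
    \<comment> \<open>As for R: the Hermitian C L equals L^* C^*, which brings C^* next to
      G.\<close>
    have "L = L * (C * L)" by (simp add: mult_assoc_mat_dim cancel)
    then have "L * G = L * (mat_adjoint (C * L) * G)" by (simp add: herm mult_assoc_mat_dim cancel)
    also have "\<dots> = L * (mat_adjoint L * (mat_adjoint C * G))"
      by (simp add: mat_adjoint_mult mult_assoc_mat_dim)
    also have "\<dots> = 0\<^sub>m r (m - r)" by (simp add: CG)
    finally have "C * L + G * mat_adjoint G = 1\<^sub>m m"
      using carr G GC LC r_le by (intro complementary_bases_resolution[of C m r G "m - r"]) auto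
    then show ?thesis by (simp add: pinv AX)
  qed
qed

section \<open>Matrix inverses, and sums of rank-one matrices as products\<close>

lemma inverse_mat_minv:
  assumes "B \<in> carrier_mat n n" "B' \<in> carrier_mat n n" "B * B' = 1\<^sub>m n"
  shows "invertible_mat B" "minv B = B'"
proof -
  have B'B: "B' * B = 1\<^sub>m n" using mat_mult_left_right_inverse assms by blast
  then show "invertible_mat B"
    using assms by (auto simp: invertible_mat_def inverts_mat_def)
  \<comment> \<open>Being a unit rules out the result \<open>None\<close>, so \<open>minv B\<close>
    is a genuine inverse; uniqueness of inverses identifies it.\<close>
  have "B \<in> Units (ring_mat TYPE('a) n ())"
    using assms B'B by (auto simp: Units_def ring_mat_def)
  then obtain C where C: "mat_inverse B = Some C"
    using mat_inverse(1)[OF assms(1)] by (metis option.exhaust)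
  from mat_inverse(2)[OF assms(1) C] have "B' * (B * C) = B'" "C \<in> carrier_mat n n"
    using assms by auto
  then have "C = B'" using assms B'B by (subst (asm) reassoc_mat[OF B'B]) auto
  then show "minv B = B'" using C by simp
qed

text \<open>Carrier and entries are proved together because the induction step can read off entries
  of a sum only when the dimensions of the partial sum are known.\<close>

lemma mat_sum_index:
  fixes M :: "'i \<Rightarrow> 'a :: field mat"
  assumes "finite I" "\<And>k. k \<in> I \<Longrightarrow> M k \<in> carrier_mat nr nc"
  shows "mat_sum nr nc M I \<in> carrier_mat nr nc \<and>
    (\<forall>i<nr. \<forall>j<nc. mat_sum nr nc M I $$ (i, j) = (\<Sum>k\<in>I. M k $$ (i, j)))"
proof -
  interpret abelian_group "module_mat TYPE('a) nr nc" by (rule abelian_group_mat)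
  show ?thesis
    using assms
  proof (induction I rule: finite_induct)
    case empty
    then show ?case by (simp add: module_mat_simps)
  next
    case (insert k I)
    then have "mat_sum nr nc M (insert k I) = M k + mat_sum nr nc M I"
      by (subst finsum_insert) (auto simp: module_mat_simps)
    moreover have "dim_row (mat_sum nr nc M I) = nr" "dim_col (mat_sum nr nc M I) = nc"
      using insert by auto
    ultimately show ?case using insert by simp
  qed
qed

text \<open>The families are indexed from 1, matrix columns from 0.\<close>

definition family_mat :: "nat \<Rightarrow> nat \<Rightarrow> (nat \<Rightarrow> 'a vec) \<Rightarrow> 'a mat" where
  "family_mat n p f = mat n p (\<lambda>(i, j). f (Suc j) $ i)"

lemma dim_family_mat [simp]:
  "dim_row (family_mat n p f) = n" "dim_col (family_mat n p f) = p"
  by (auto simp: family_mat_def)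

text \<open>Replaces every sum in the theorem by a product F diag(c) G^*, so that what remains is
  algebra with a few matrices.\<close>

lemma mat_sum_outer:
  fixes f g :: "nat \<Rightarrow> 'a :: conjugatable_field vec"
  assumes f: "\<And>k. k \<in> {1..p} \<Longrightarrow> f k \<in> carrier_vec n"
    and g: "\<And>k. k \<in> {1..p} \<Longrightarrow> g k \<in> carrier_vec m"
  shows "mat_sum n m (\<lambda>k. c k \<cdot>\<^sub>m outer (f k) (g k)) {1..p} =
    family_mat n p f * (mat_diag p (\<lambda>i. c (Suc i)) * mat_adjoint (family_mat m p g))"
    (is "?S = ?F * (?D * ?G)")
proof -
  have dims: "dim_vec (f k) = n" "dim_vec (g k) = m" if "k \<in> {1..p}" for k
    using f g that by auto
  have *: "?S \<in> carrier_mat n m \<and> (\<forall>i<n. \<forall>j<m. ?S $$ (i, j) =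
      (\<Sum>k\<in>{1..p}. (c k \<cdot>\<^sub>m outer (f k) (g k)) $$ (i, j)))"
    by (rule mat_sum_index) (auto simp: outer_def dims)
  have DG: "?D * ?G = mat p m (\<lambda>(i, j). c (Suc i) * ?G $$ (i, j))"
    by (rule mat_diag_mult_left) auto
  show ?thesis
  proof (rule eq_matI)
    fix i j assume "i < dim_row (?F * (?D * ?G))" "j < dim_col (?F * (?D * ?G))"
    then have ij: "i < n" "j < m" by auto
    have "?S $$ (i, j) = (\<Sum>k = 1..p. c k * (f k $ i * conjugate (g k $ j)))"
      using * ij by (auto simp: outer_def dims intro!: sum.cong)
    also have "\<dots> = (\<Sum>k<p. c (Suc k) * (f (Suc k) $ i * conjugate (g (Suc k) $ j)))"
      by (simp add: sum.atLeast1_atMost_eq)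
    also have "\<dots> = (?F * (?D * ?G)) $$ (i, j)"
      unfolding DG using ij by (auto simp: scalar_prod_def lessThan_atLeast0 family_mat_def ac_simps intro!: sum.cong)
    finally show "?S $$ (i, j) = (?F * (?D * ?G)) $$ (i, j)" .
  qed (use * in auto)
qed

lemma family_mat_orthonormal:
  assumes f: "\<And>k. k \<in> {1..p} \<Longrightarrow> f k \<in> carrier_vec n"
    and orth: "orthonormal_family {1..p} f"
  shows "mat_adjoint (family_mat n p f) * family_mat n p f = 1\<^sub>m p"
proof (rule eq_matI)
  fix i j assume "i < dim_row (1\<^sub>m p :: 'a mat)" "j < dim_col (1\<^sub>m p :: 'a mat)"
  then have ij: "i < p" "j < p" by auto
  \<comment> \<open>The indices swap because \<open>\<bullet>c\<close> conjugates its second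
    argument.\<close>
  have "(mat_adjoint (family_mat n p f) * family_mat n p f) $$ (i, j) = f (Suc j) \<bullet>c f (Suc i)"
    using ij f[of "Suc i"] by (auto simp: scalar_prod_def family_mat_def ac_simps intro!: sum.cong)
  also have "\<dots> = 1\<^sub>m p $$ (i, j)"
    using ij orth unfolding orthonormal_family_def by auto
  finally show "(mat_adjoint (family_mat n p f) * family_mat n p f) $$ (i, j) = 1\<^sub>m p $$ (i, j)" .
qed auto

lemma family_mat_kernel:
  assumes A: "A \<in> carrier_mat m n" and f: "\<And>k. k \<in> {1..p} \<Longrightarrow> f k \<in> mat_kernel A"
  shows "A * family_mat n p f = 0\<^sub>m m p"
proof (rule mat_col_eqI)
  fix j assume "j < dim_col (0\<^sub>m m p :: 'a mat)"
  then have j: "j < p" by simp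
  then have fj: "f (Suc j) \<in> carrier_vec n" "A *\<^sub>v f (Suc j) = 0\<^sub>v m"
    using mat_kernelD[OF A f[of "Suc j"]] by auto
  have "col (family_mat n p f) j = f (Suc j)"
    using fj j by (intro eq_vecI) (auto simp: family_mat_def)
  then show "col (A * family_mat n p f) j = col (0\<^sub>m m p) j"
    using fj j A by (subst col_mult2[OF A, of _ p]) (auto simp: family_mat_def)
qed (use A in auto)

section \<open>The relations between A, X, F and G, and the three explicit inverses\<close>

lemma add_zero_mat_dim:
  fixes X :: "'a :: monoid_add mat"
  assumes "dim_row X = nr" "dim_col X = nc"
  shows "0\<^sub>m nr nc + X = X" "X + 0\<^sub>m nr nc = X"
  using assms by (auto intro!: eq_matI)

lemma add_diff_cancel_mat:
  fixes X :: "'a :: ab_group_add mat"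
  assumes "X \<in> carrier_mat nr nc" "Y \<in> carrier_mat nr nc"
  shows "X + Y - Y = X"
  using assms by (intro eq_matI) auto

text \<open>D stands for the diagonal matrix of the d_k and E for its inverse; the algebra sees them
  only through D E = E D = 1.\<close>

locale pinv_kernel_families =
  fixes A F G D E :: "'a :: conjugatable_ordered_field mat" and m n r p :: nat
  assumes A: "A \<in> carrier_mat m n" and r: "r = vec_space.rank m A" and p: "p = min m n - r"
    and F: "F \<in> carrier_mat n p" "A * F = 0\<^sub>m m p" "mat_adjoint F * F = 1\<^sub>m p"
    and G: "G \<in> carrier_mat m p" "mat_adjoint A * G = 0\<^sub>m n p" "mat_adjoint G * G = 1\<^sub>m p"
    and D: "D \<in> carrier_mat p p" and E: "E \<in> carrier_mat p p" and DE: "D * E = 1\<^sub>m p"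
begin

abbreviation "X \<equiv> pinv A"

lemma dims [simp]: "dim_row A = m" "dim_col A = n" "dim_row X = n" "dim_col X = m"
  "dim_row F = n" "dim_col F = p" "dim_row G = m" "dim_col G = p"
  "dim_row D = p" "dim_col D = p" "dim_row E = p" "dim_col E = p"
  using A F G D E pinv_resolutions(1)[OF A r] by (auto simp: is_moore_penrose_def)

text \<open>The Penrose equations oriented for rewriting: products nest to the right, and a product
  of adjoints becomes one of the projectors A X and X A.\<close>

lemma X: "A * (X * A) = A" "X * (A * X) = X"
  "mat_adjoint X * mat_adjoint A = A * X" "mat_adjoint A * mat_adjoint X = X * A"
  using pinv_resolutions(1)[OF A r]
  by (auto simp: is_moore_penrose_def mult_assoc_mat_dim mat_adjoint_mult)

lemma ED: "E * D = 1\<^sub>m p"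
  using mat_mult_left_right_inverse[OF D E DE] .

text \<open>X = X A X = X X^* A^*, and A^* annihilates G.\<close>

lemma XG: "X * G = 0\<^sub>m n p"
proof -
  have "X * (mat_adjoint X * mat_adjoint A) * G = X * (mat_adjoint X * (mat_adjoint A * G))"
    by (simp add: mult_assoc_mat_dim)
  then show ?thesis by (simp add: G X)
qed

lemma FA: "mat_adjoint F * mat_adjoint A = 0\<^sub>m p m"
  by (simp add: F flip: mat_adjoint_mult)

lemma GA: "mat_adjoint G * A = 0\<^sub>m p n"
proof -
  have "mat_adjoint G * A = mat_adjoint (mat_adjoint A * G)" by (simp add: mat_adjoint_mult)
  then show ?thesis by (simp add: G)
qed

text \<open>X = X A X = A^* X^* X, and F^* annihilates A^* from the left.\<close>

lemma FX: "mat_adjoint F * X = 0\<^sub>m p m"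
proof -
  have "mat_adjoint F * (mat_adjoint A * (mat_adjoint X * X)) = mat_adjoint F * X"
    by (simp add: reassoc_mat[OF X(4)] mult_assoc_mat_dim X)
  then show ?thesis by (simp add: reassoc_mat[OF FA])
qed

lemma XF: "mat_adjoint X * F = 0\<^sub>m m p"
proof -
  have "mat_adjoint X * F = mat_adjoint (mat_adjoint F * X)" by (simp add: mat_adjoint_mult)
  then show ?thesis by (simp add: FX)
qed

lemma GX: "mat_adjoint G * mat_adjoint X = 0\<^sub>m p n"
  by (simp add: XG flip: mat_adjoint_mult)

lemmas relations = F(2,3) G(2,3) DE ED X(2-) XG FA GA FX XF GX

text \<open>Expands to sums of right-nested products and evaluates them. Each relation is given
  twice: as it stands for the end of a chain, and through \<open>reassoc_mat\<close> for its
  interior.\<close>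

lemmas collapse = mat_distribs add_zero_mat_dim relations relations[THEN reassoc_mat]

text \<open>For complex d_k the term with D D involves d_k^2, not |d_k|^2, so B need not be
  Hermitian. Invertibility therefore comes from an explicit inverse rather than from positive
  definiteness.\<close>

lemma invertible_tall:
  assumes "n \<le> m"
  defines "B \<equiv> mat_adjoint A * A + F * (D * D * mat_adjoint F)"
  shows "invertible_mat B \<and>
    X = minv B * (mat_adjoint A + F * (D * mat_adjoint G)) - F * (E * mat_adjoint G)"
proof -
  let ?B' = "X * mat_adjoint X + F * (E * E * mat_adjoint F)"
  \<comment> \<open>Here min m n = n, so F has the n - r columns of a full basis of N(A).\<close>
  have "X * A + F * mat_adjoint F = 1\<^sub>m n"
    using pinv_resolutions(2)[OF A r] F p assms by (simp add: min_absorb2)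
  \<comment> \<open>This chain needs A^* A X = A^*, the adjoint of A X A = A; then A^* X^* = X A
    remains.\<close>
  moreover have "mat_adjoint A * (A * (X * mat_adjoint X)) = X * A"
  proof -
    have "mat_adjoint (A * X * A) = mat_adjoint A * (mat_adjoint X * mat_adjoint A)"
      by (simp add: mat_adjoint_mult)
    then have "mat_adjoint A * (A * X) = mat_adjoint A" by (simp add: X mult_assoc_mat_dim)
    from reassoc_mat[OF this, of "mat_adjoint X"] show ?thesis
      by (simp add: X mult_assoc_mat_dim)
  qed
  ultimately have "B * ?B' = 1\<^sub>m n"
    by (simp add: B_def collapse)
  then have inv: "invertible_mat B" "minv B = ?B'"
    by (intro inverse_mat_minv[of B n ?B'] carrier_matI; simp add: B_def)+
  \<comment> \<open>The mixed terms vanish by X^* F = 0 and F^* A^* = 0, and E E D = E leaves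
    exactly the term that the formula subtracts.\<close>
  have "?B' * (mat_adjoint A + F * (D * mat_adjoint G)) = X + F * (E * mat_adjoint G)"
    by (simp add: collapse)
  then show ?thesis
    unfolding inv(2) by (simp add: inv(1) add_diff_cancel_mat[of _ n m] carrier_matI)
qed

lemma invertible_wide:
  assumes "m \<le> n"
  defines "B \<equiv> A * mat_adjoint A + G * (D * D * mat_adjoint G)"
  shows "invertible_mat B \<and>
    X = (mat_adjoint A + F * (D * mat_adjoint G)) * minv B - F * (E * mat_adjoint G)"
proof -
  let ?B' = "mat_adjoint X * X + G * (E * E * mat_adjoint G)"
  have "A * X + G * mat_adjoint G = 1\<^sub>m m"
    using pinv_resolutions(3)[OF A r] G p assms by (simp add: min_absorb1)
  then have "B * ?B' = 1\<^sub>m m"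
    by (simp add: B_def collapse)
  then have inv: "invertible_mat B" "minv B = ?B'"
    by (intro inverse_mat_minv[of B m ?B'] carrier_matI; simp add: B_def)+
  have "(mat_adjoint A + F * (D * mat_adjoint G)) * ?B' = X + F * (E * mat_adjoint G)"
    by (simp add: collapse)
  then show ?thesis
    unfolding inv(2) by (simp add: inv(1) add_diff_cancel_mat[of _ n m] carrier_matI)
qed

lemma invertible_square:
  assumes "m = n"
  defines "B \<equiv> A + G * (D * mat_adjoint F)"
  shows "invertible_mat B \<and> X = minv B - F * (E * mat_adjoint G)"
proof -
  let ?B' = "X + F * (E * mat_adjoint G)"
  have "A * X + G * mat_adjoint G = 1\<^sub>m m"
    using pinv_resolutions(3)[OF A r] G p assms by (simp add: min_absorb1)
  \<comment> \<open>A F = 0 and F^* X = 0 remove the mixed terms; F^* F = 1 and D E = 1 reduce the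
    last one to G G^*.\<close>
  then have "B * ?B' = 1\<^sub>m m" by (simp add: B_def collapse)
  then have inv: "invertible_mat B" "minv B = ?B'"
    using assms by (intro inverse_mat_minv[of B m ?B'] carrier_matI; simp add: B_def)+
  show ?thesis
    unfolding inv(2) by (simp add: inv(1) add_diff_cancel_mat[of _ n m] carrier_matI)
qed

end

section \<open>The three formulas for families of vectors\<close>

lemma pinv_rank_one_updates:
  fixes A :: "'a :: conjugatable_ordered_field mat" and f g :: "nat \<Rightarrow> 'a vec" and d :: "nat \<Rightarrow> 'a"
  assumes A: "A \<in> carrier_mat m n" and r: "r = vec_space.rank m A" and q: "q = min m n"
    and f: "\<forall>k\<in>{1..q - r}. f k \<in> mat_kernel A" "orthonormal_family {1..q - r} f"
    and g: "\<forall>k\<in>{1..q - r}. g k \<in> mat_kernel (mat_adjoint A)" "orthonormal_family {1..q - r} g"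
    and d: "\<forall>k\<in>{1..q - r}. d k \<noteq> 0"
  defines "S \<equiv> mat_sum n m (\<lambda>k. d k \<cdot>\<^sub>m outer (f k) (g k)) {1..q - r}"
    and "T \<equiv> mat_sum n m (\<lambda>k. (1 / d k) \<cdot>\<^sub>m outer (f k) (g k)) {1..q - r}"
    and "B\<^sub>1 \<equiv> mat_adjoint A * A + mat_sum n n (\<lambda>k. (d k)^2 \<cdot>\<^sub>m outer (f k) (f k)) {1..q - r}"
    and "B\<^sub>2 \<equiv> A * mat_adjoint A + mat_sum m m (\<lambda>k. (d k)^2 \<cdot>\<^sub>m outer (g k) (g k)) {1..q - r}"
    and "B\<^sub>3 \<equiv> A + mat_sum m n (\<lambda>k. d k \<cdot>\<^sub>m outer (g k) (f k)) {1..q - r}"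
  shows "(m \<ge> n \<longrightarrow> invertible_mat B\<^sub>1 \<and> pinv A = minv B\<^sub>1 * (mat_adjoint A + S) - T) \<and>
    (n \<ge> m \<longrightarrow> invertible_mat B\<^sub>2 \<and> pinv A = (mat_adjoint A + S) * minv B\<^sub>2 - T) \<and>
    (m = n \<longrightarrow> invertible_mat B\<^sub>3 \<and> pinv A = minv B\<^sub>3 - T)"
proof -
  define p where "p = q - r"
  let ?F = "family_mat n p f" and ?G = "family_mat m p g"
  let ?D = "mat_diag p (\<lambda>i. d (Suc i))" and ?E = "mat_diag p (\<lambda>i. 1 / d (Suc i))"
  have fc: "f k \<in> carrier_vec n" and gc: "g k \<in> carrier_vec m" if "k \<in> {1..p}" for k
    using f(1) g(1) that mat_kernelD(1)[OF A] mat_kernelD(1)[OF mat_adjoint_carrier[OF A]]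
    by (auto simp: p_def)
  have DE: "?D * ?E = 1\<^sub>m p"
    using d unfolding mat_diag_diag by (auto simp: mat_diag_def p_def intro!: eq_matI)
  interpret pinv_kernel_families A ?F ?G ?D ?E m n r p
  proof (unfold_locales, rule A, rule r)
    show "p = min m n - r" by (simp add: p_def q)
    show "A * ?F = 0\<^sub>m m p"
      using f(1) by (intro family_mat_kernel[OF A]) (simp add: p_def)
    show "mat_adjoint A * ?G = 0\<^sub>m n p"
      using g(1) by (intro family_mat_kernel[OF mat_adjoint_carrier[OF A]]) (simp add: p_def)
    show "mat_adjoint ?F * ?F = 1\<^sub>m p"
      using f(2) fc by (intro family_mat_orthonormal) (simp_all add: p_def)
    show "mat_adjoint ?G * ?G = 1\<^sub>m p"
      using g(2) gc by (intro family_mat_orthonormal) (simp_all add: p_def)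
  \<comment> \<open>Keeps the product of the two diagonal matrices in the form in which
    \<open>DE\<close> rewrites it.\<close>
  qed (auto simp: DE simp del: mat_diag_diag)
  have DD: "?D * ?D = mat_diag p (\<lambda>i. (d (Suc i))^2)"
    by (simp add: power2_eq_square)
  have S: "S = ?F * (?D * mat_adjoint ?G)" and T: "T = ?F * (?E * mat_adjoint ?G)"
    and B\<^sub>1: "B\<^sub>1 = mat_adjoint A * A + ?F * (?D * ?D * mat_adjoint ?F)"
    and B\<^sub>2: "B\<^sub>2 = A * mat_adjoint A + ?G * (?D * ?D * mat_adjoint ?G)"
    and B\<^sub>3: "B\<^sub>3 = A + ?G * (?D * mat_adjoint ?F)"
    unfolding S_def T_def B\<^sub>1_def B\<^sub>2_def B\<^sub>3_def DD p_def[symmetric]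
    by (simp_all only: mat_sum_outer[OF fc gc] mat_sum_outer[OF gc fc]
        mat_sum_outer[OF fc fc] mat_sum_outer[OF gc gc])
  show ?thesis
    unfolding S T B\<^sub>1 B\<^sub>2 B\<^sub>3
    by (intro conjI[of "_ \<longrightarrow> _"] impI invertible_tall invertible_wide invertible_square)
qed

theorem corollary3p2:
  fixes m n q :: nat
  assumes "q = min m n"
  shows
    "(\<forall>(A :: real mat) (f :: nat \<Rightarrow> real vec) (g :: nat \<Rightarrow> real vec) (d :: nat \<Rightarrow> real) r.
       A \<in> carrier_mat m n \<longrightarrow>
       r = vec_space.rank m A \<longrightarrow>
       (\<forall>k\<in>{1..q - r}. f k \<in> mat_kernel A) \<longrightarrow> orthonormal_family {1..q - r} f \<longrightarrow>
       (\<forall>k\<in>{1..q - r}. g k \<in> mat_kernel (mat_adjoint A)) \<longrightarrow> orthonormal_family {1..q - r} g \<longrightarrow>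
       (\<forall>k\<in>{1..q - r}. d k \<noteq> 0) \<longrightarrow>
         (m \<ge> n \<longrightarrow>
            invertible_mat (mat_adjoint A * A + mat_sum n n (\<lambda>k. (d k)^2 \<cdot>\<^sub>m outer (f k) (f k)) {1..q - r}) \<and>
            pinv A =
              minv (mat_adjoint A * A + mat_sum n n (\<lambda>k. (d k)^2 \<cdot>\<^sub>m outer (f k) (f k)) {1..q - r})
                * (mat_adjoint A + mat_sum n m (\<lambda>k. d k \<cdot>\<^sub>m outer (f k) (g k)) {1..q - r})
              - mat_sum n m (\<lambda>k. (1 / d k) \<cdot>\<^sub>m outer (f k) (g k)) {1..q - r}) \<and>
         (n \<ge> m \<longrightarrow>
            invertible_mat (A * mat_adjoint A + mat_sum m m (\<lambda>k. (d k)^2 \<cdot>\<^sub>m outer (g k) (g k)) {1..q - r}) \<and>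
            pinv A =
              (mat_adjoint A + mat_sum n m (\<lambda>k. d k \<cdot>\<^sub>m outer (f k) (g k)) {1..q - r})
                * minv (A * mat_adjoint A + mat_sum m m (\<lambda>k. (d k)^2 \<cdot>\<^sub>m outer (g k) (g k)) {1..q - r})
              - mat_sum n m (\<lambda>k. (1 / d k) \<cdot>\<^sub>m outer (f k) (g k)) {1..q - r}) \<and>
         (m = n \<longrightarrow>
            invertible_mat (A + mat_sum m n (\<lambda>k. d k \<cdot>\<^sub>m outer (g k) (f k)) {1..q - r}) \<and>
            pinv A =
              minv (A + mat_sum m n (\<lambda>k. d k \<cdot>\<^sub>m outer (g k) (f k)) {1..q - r})
              - mat_sum n m (\<lambda>k. (1 / d k) \<cdot>\<^sub>m outer (f k) (g k)) {1..q - r}))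
     \<and>
     (\<forall>(A :: complex mat) (f :: nat \<Rightarrow> complex vec) (g :: nat \<Rightarrow> complex vec) (d :: nat \<Rightarrow> complex) r.
       A \<in> carrier_mat m n \<longrightarrow>
       r = vec_space.rank m A \<longrightarrow>
       (\<forall>k\<in>{1..q - r}. f k \<in> mat_kernel A) \<longrightarrow> orthonormal_family {1..q - r} f \<longrightarrow>
       (\<forall>k\<in>{1..q - r}. g k \<in> mat_kernel (mat_adjoint A)) \<longrightarrow> orthonormal_family {1..q - r} g \<longrightarrow>
       (\<forall>k\<in>{1..q - r}. d k \<noteq> 0) \<longrightarrow>
         (m \<ge> n \<longrightarrow>
            invertible_mat (mat_adjoint A * A + mat_sum n n (\<lambda>k. (d k)^2 \<cdot>\<^sub>m outer (f k) (f k)) {1..q - r}) \<and>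
            pinv A =
              minv (mat_adjoint A * A + mat_sum n n (\<lambda>k. (d k)^2 \<cdot>\<^sub>m outer (f k) (f k)) {1..q - r})
                * (mat_adjoint A + mat_sum n m (\<lambda>k. d k \<cdot>\<^sub>m outer (f k) (g k)) {1..q - r})
              - mat_sum n m (\<lambda>k. (1 / d k) \<cdot>\<^sub>m outer (f k) (g k)) {1..q - r}) \<and>
         (n \<ge> m \<longrightarrow>
            invertible_mat (A * mat_adjoint A + mat_sum m m (\<lambda>k. (d k)^2 \<cdot>\<^sub>m outer (g k) (g k)) {1..q - r}) \<and>
            pinv A =
              (mat_adjoint A + mat_sum n m (\<lambda>k. d k \<cdot>\<^sub>m outer (f k) (g k)) {1..q - r})
                * minv (A * mat_adjoint A + mat_sum m m (\<lambda>k. (d k)^2 \<cdot>\<^sub>m outer (g k) (g k)) {1..q - r})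
              - mat_sum n m (\<lambda>k. (1 / d k) \<cdot>\<^sub>m outer (f k) (g k)) {1..q - r}) \<and>
         (m = n \<longrightarrow>
            invertible_mat (A + mat_sum m n (\<lambda>k. d k \<cdot>\<^sub>m outer (g k) (f k)) {1..q - r}) \<and>
            pinv A =
              minv (A + mat_sum m n (\<lambda>k. d k \<cdot>\<^sub>m outer (g k) (f k)) {1..q - r})
              - mat_sum n m (\<lambda>k. (1 / d k) \<cdot>\<^sub>m outer (f k) (g k)) {1..q - r}))"
  \<comment> \<open>Both \<open>real\<close> and \<open>complex\<close> are instances of
    \<open>conjugatable_ordered_field\<close>, so one lemma serves both conjuncts.\<close>
  by (rule conjI; intro allI impI; rule pinv_rank_one_updates[OF _ _ assms]; assumption)

end
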